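(* Let $N\ge2$ be an integer, let $q\in\Bbbk$ be a primitive $N$-th root of unity, and consider the Taft Hopf algebra $$A=\Bbbk\langle g,x\mid g^N=1,\ x^N=0,\ gx=qxg\rangle .$$ Let $R$ be the subalgebra of $A$ generated by $x$ and, for $s,t=0,\dots,N-1$, set $N_{s,t}:=e_sx^tR$. Then the $N_{s,t}$ form an irredundant set of representatives of $\mathcal{L}_{\mathrm{in}}(A_A)$ (that is, every indecomposable right ideal of $A$ is isomorphic, as a right $A$-module, to exactly one of the $N_{s,t}$, each of which is itself an indecomposable right ideal), and $$\mathcal{L}_{\mathrm{in}}(A_A)=\{(1+rx)N_{s,t}\mid r\in R,\ 0\le s,t\le N-1\}.$$
   Context: $\Bbbk$ is a field. For $t\in\mathbb{Z}$, $e_t:=\frac1N\sum_{i=0}^{N-1}q^{ti}g^i\in A$. $A$ has $\Bbbk$-basis $\{x^ng^a\mid 0\le n,a\le N-1\}$. $\mathcal{L}_{\mathrm{in}}(A_A)$ denotes the set of right ideals of $A$ that are indecomposable as right $A$-modules (in particular non-zero). *)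

theory Defs
  imports Complex_Main "HOL-Library.Poly_Mapping"
begin

locale associative_algebra = vector_space scale
  for scale :: "'k::field \<Rightarrow> 'a::ring_1 \<Rightarrow> 'a" (infixr "*s" 75) +
  assumes scale_mult_left: "(c *s a) * b = c *s (a * b)"
    and scale_mult_right: "a * (c *s b) = c *s (a * b)"

definition subalgebra :: "('k::field \<Rightarrow> 'a::ring_1 \<Rightarrow> 'a) \<Rightarrow> 'a set \<Rightarrow> bool" where
  "subalgebra scale S \<longleftrightarrow>
     1 \<in> S \<and> (\<forall>a\<in>S. \<forall>b\<in>S. a + b \<in> S \<and> a * b \<in> S) \<and> (\<forall>c. \<forall>a\<in>S. scale c a \<in> S)"

definition two_sided_ideal :: "'a::ring_1 set \<Rightarrow> bool" where
  "two_sided_ideal I \<longleftrightarrow>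
     0 \<in> I \<and> (\<forall>a\<in>I. \<forall>b\<in>I. a + b \<in> I) \<and> (\<forall>a\<in>I. \<forall>r. r * a \<in> I \<and> a * r \<in> I)"

text \<open>The free monoid is written additively, so that the convolution product of
  \<open>HOL-Library.Poly_Mapping\<close> makes \<open>'i free_monoid \<Rightarrow>\<^sub>0 'k\<close> its monoid algebra, that is, the
  free associative unital \<open>'k\<close>-algebra on \<open>'i\<close>.\<close>

datatype 'i free_monoid = Word (letters: "'i list")

instantiation free_monoid :: (type) monoid_add
begin

definition zero_free_monoid :: "'a free_monoid" where
  "zero_free_monoid = Word []"

definition plus_free_monoid :: "'a free_monoid \<Rightarrow> 'a free_monoid \<Rightarrow> 'a free_monoid" where
  "plus_free_monoid u v = Word (letters u @ letters v)"

instance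
  by standard (simp_all add: zero_free_monoid_def plus_free_monoid_def)

end

type_synonym ('i, 'k) free_algebra = "'i free_monoid \<Rightarrow>\<^sub>0 'k"

definition free_gen :: "'i \<Rightarrow> ('i, 'k::field) free_algebra" where
  "free_gen i = Poly_Mapping.single (Word [i]) 1"

definition free_const :: "'k::field \<Rightarrow> ('i, 'k) free_algebra" where
  "free_const c = Poly_Mapping.single 0 c"

definition free_eval ::
  "('k::field \<Rightarrow> 'a::ring_1 \<Rightarrow> 'a) \<Rightarrow> ('i \<Rightarrow> 'a) \<Rightarrow> ('i, 'k) free_algebra \<Rightarrow> 'a" where
  "free_eval scale v p =
     (\<Sum>w\<in>Poly_Mapping.keys p. scale (Poly_Mapping.lookup p w) (prod_list (map v (letters w))))"

text \<open>The algebra is presented by the generators \<open>v i\<close> and the relations \<open>p = 0\<close>,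
  \<open>p \<in> rels\<close>: evaluation at \<open>v\<close> induces an isomorphism from the quotient of the free algebra
  by the two-sided ideal generated by \<open>rels\<close>.\<close>

definition presented_algebra ::
  "('k::field \<Rightarrow> 'a::ring_1 \<Rightarrow> 'a) \<Rightarrow> ('i \<Rightarrow> 'a) \<Rightarrow> ('i, 'k) free_algebra set \<Rightarrow> bool" where
  "presented_algebra scale v rels \<longleftrightarrow>
     associative_algebra scale \<and>
     surj (free_eval scale v) \<and>
     {p. free_eval scale v p = 0} = two_sided_ideal hull rels"

definition right_ideal :: "'a::ring_1 set \<Rightarrow> bool" where
  "right_ideal I \<longleftrightarrow>
     0 \<in> I \<and> (\<forall>a\<in>I. \<forall>b\<in>I. a + b \<in> I) \<and> (\<forall>a\<in>I. \<forall>r. a * r \<in> I)"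

text \<open>The submodules of a right ideal are the right ideals contained in it.\<close>

definition indecomposable_right_ideal :: "'a::ring_1 set \<Rightarrow> bool" where
  "indecomposable_right_ideal I \<longleftrightarrow>
     right_ideal I \<and> I \<noteq> {0} \<and>
     (\<forall>J K. right_ideal J \<and> right_ideal K \<and> J \<inter> K = {0} \<and> I = {a + b | a b. a \<in> J \<and> b \<in> K}
        \<longrightarrow> J = {0} \<or> K = {0})"

definition indecomposable_right_ideals :: "'a::ring_1 set set" where
  "indecomposable_right_ideals = {I. indecomposable_right_ideal I}"

definition right_module_isomorphic :: "'a::ring_1 set \<Rightarrow> 'a set \<Rightarrow> bool" where
  "right_module_isomorphic I J \<longleftrightarrow>
     (\<exists>f. bij_betw f I J \<and> (\<forall>a\<in>I. \<forall>b\<in>I. f (a + b) = f a + f b) \<and>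
          (\<forall>a\<in>I. \<forall>r. f (a * r) = f a * r))"

definition primitive_root_of_unity :: "nat \<Rightarrow> 'k::field \<Rightarrow> bool" where
  "primitive_root_of_unity n q \<longleftrightarrow> q ^ n = 1 \<and> (\<forall>m. 0 < m \<and> m < n \<longrightarrow> q ^ m \<noteq> 1)"

datatype taft_gen = Gen_g | Gen_x

definition taft_relations :: "nat \<Rightarrow> 'k::field \<Rightarrow> (taft_gen, 'k) free_algebra set" where
  "taft_relations N q =
     {free_gen Gen_g ^ N - 1,
      free_gen Gen_x ^ N,
      free_gen Gen_g * free_gen Gen_x - free_const q * free_gen Gen_x * free_gen Gen_g}"

definition taft_algebra ::
  "('k::field \<Rightarrow> 'a::ring_1 \<Rightarrow> 'a) \<Rightarrow> nat \<Rightarrow> 'k \<Rightarrow> 'a \<Rightarrow> 'a \<Rightarrow> bool" where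
  "taft_algebra scale N q g x \<longleftrightarrow>
     presented_algebra scale (case_taft_gen g x) (taft_relations N q)"

text \<open>\<open>N\<close> is invertible in \<open>'k\<close> whenever \<open>q\<close> is a primitive \<open>N\<close>-th root of unity.\<close>

definition taft_e :: "('k::field \<Rightarrow> 'a::ring_1 \<Rightarrow> 'a) \<Rightarrow> nat \<Rightarrow> 'k \<Rightarrow> 'a \<Rightarrow> int \<Rightarrow> 'a" where
  "taft_e scale N q g t =
     scale (1 / of_nat N) (\<Sum>i = 0..N - 1. scale (q powi (t * int i)) (g ^ i))"

definition taft_R :: "('k::field \<Rightarrow> 'a::ring_1 \<Rightarrow> 'a) \<Rightarrow> 'a \<Rightarrow> 'a set" where
  "taft_R scale x = subalgebra scale hull {x}"

definition taft_N ::
  "('k::field \<Rightarrow> 'a::ring_1 \<Rightarrow> 'a) \<Rightarrow> nat \<Rightarrow> 'k \<Rightarrow> 'a \<Rightarrow> 'a \<Rightarrow> nat \<Rightarrow> nat \<Rightarrow> 'a set" where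
  "taft_N scale N q g x s t =
     {taft_e scale N q g (int s) * x ^ t * r | r. r \<in> taft_R scale x}"

end

theory Submission
  imports Defs "HOL-Computational_Algebra.Polynomial"
begin

text \<open>Since \<open>q\<close> is a primitive \<open>N\<close>-th root of unity, \<open>g\<close> acts diagonalisably, with eigenprojections
  the idempotents \<open>e s\<close>; they are orthogonal, depend on \<open>s\<close> modulo \<open>N\<close>, sum to \<open>1\<close>, and satisfy
  \<open>e s * x = x * e (s + 1)\<close>. So the Taft algebra is the path algebra of a cyclic quiver with \<open>N\<close>
  vertices in which all paths of length \<open>N\<close> vanish: the elements \<open>e s * x ^ n\<close> with \<open>n < N\<close> are its
  paths. It is spanned by them (\<open>span_x_power_e\<close>), and the longest ones are non-zero
  (\<open>x_power_pred_e_nonzero\<close>), which a representation on sequences shows. The classification uses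
  only these facts.

  \<^item> The subalgebra \<open>R\<close> generated by \<open>x\<close> is a truncated polynomial ring, so each of its non-zero
    elements is a power of \<open>x\<close> times a scalar times a unit \<open>1 + r * x\<close> (\<open>R_leading_term\<close>). Hence
    every non-zero element of the right ideal \<open>e s * x ^ t * R\<close> has a multiple equal to
    \<open>e s * x ^ (N - 1)\<close>. No two non-zero submodules intersect trivially, and the right ideal is
    indecomposable, as are its images under left multiplication by units.

  \<^item> These right ideals are told apart by their annihilators: the powers of \<open>x\<close> that kill
    \<open>e s * x ^ t * R\<close> give \<open>t\<close>, and then a path of length \<open>N - 1 - t\<close> acts non-trivially only if it
    starts at the vertex \<open>s + t\<close> (\<open>taft_N_eq_if_annihilators_eq\<close>).

  \<^item> In a non-zero right ideal \<open>I\<close>, choose \<open>y\<close> with \<open>y * e j = y\<close> for some \<open>j\<close> that survives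
    multiplication by the highest power of \<open>x\<close> not killing \<open>I\<close>. As a cyclic subgroup of maximal order
    splits off a finite abelian \<open>p\<close>-group, so the right ideal generated by \<open>y\<close> is a direct summand of \<open>I\<close>
    (\<open>longest_homogeneous_splits\<close>). If \<open>I\<close> is indecomposable, it is therefore generated by \<open>y\<close>. Up
    to a scalar, \<open>y = y * e j\<close> has the form \<open>(1 + r * x) * x ^ t * e j\<close>, that is,
    \<open>(1 + r * x) * e (j - t) * x ^ t\<close> (\<open>homogeneous_principal_eq_unit_image\<close>).\<close>

section \<open>Evaluation of the free algebra\<close>

context associative_algebra
begin

lemma free_eval_superset:
  assumes "finite S" "Poly_Mapping.keys p \<subseteq> S"
  shows "free_eval scale v p = (\<Sum>w\<in>S. Poly_Mapping.lookup p w *s prod_list (map v (letters w)))"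
  unfolding free_eval_def
  by (rule sum.mono_neutral_left[OF assms]) (auto simp: in_keys_iff)

lemma free_eval_add: "free_eval scale v (p + p') = free_eval scale v p + free_eval scale v p'"
proof -
  let ?S = "Poly_Mapping.keys p \<union> Poly_Mapping.keys p'"
  have "Poly_Mapping.keys (p + p') \<subseteq> ?S"
    by (rule Poly_Mapping.keys_add)
  then show ?thesis
    by (simp add: free_eval_superset[of ?S] lookup_add scale_left_distrib sum.distrib)
qed

lemma free_eval_zero: "free_eval scale v 0 = 0"
  by (simp add: free_eval_def)

lemma free_eval_diff: "free_eval scale v (p - p') = free_eval scale v p - free_eval scale v p'"
  using free_eval_add[of v "p - p'" p'] by (simp add: algebra_simps)

lemma free_eval_sum: "free_eval scale v (sum f S) = (\<Sum>i\<in>S. free_eval scale v (f i))"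
  by (induction S rule: infinite_finite_induct) (simp_all add: free_eval_zero free_eval_add)

lemma free_eval_single:
  "free_eval scale v (Poly_Mapping.single w c) = c *s prod_list (map v (letters w))"
  by (simp add: free_eval_def)

lemma free_eval_one: "free_eval scale v 1 = 1"
  using free_eval_single[of v 0 1] unfolding single_one by (simp add: zero_free_monoid_def)

lemma free_eval_const: "free_eval scale v (free_const c) = c *s 1"
  by (simp add: free_const_def free_eval_single zero_free_monoid_def)

lemma free_eval_gen: "free_eval scale v (free_gen i) = v i"
  by (simp add: free_gen_def free_eval_single)

lemma sum_monomials:
  "p = (\<Sum>w\<in>Poly_Mapping.keys p. Poly_Mapping.single w (Poly_Mapping.lookup p w))"
  by (rule poly_mapping_eqI)
    (simp add: lookup_sum lookup_single when_def sum.delta in_keys_iff)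

lemma free_eval_mult: "free_eval scale v (p * p') = free_eval scale v p * free_eval scale v p'"
proof -
  let ?m = "\<lambda>p w. Poly_Mapping.single w (Poly_Mapping.lookup p w)"
  have single: "free_eval scale v (Poly_Mapping.single w c * Poly_Mapping.single w' c') =
      free_eval scale v (Poly_Mapping.single w c) * free_eval scale v (Poly_Mapping.single w' c')"
    for w w' c c'
    by (simp add: mult_single free_eval_single plus_free_monoid_def scale_mult_left
        scale_mult_right)
  have "p * p' = (\<Sum>w\<in>Poly_Mapping.keys p. \<Sum>w'\<in>Poly_Mapping.keys p'. ?m p w * ?m p' w')"
    by (subst sum_monomials[of p], subst sum_monomials[of p'], rule sum_product)
  then have "free_eval scale v (p * p') = (\<Sum>w\<in>Poly_Mapping.keys p. \<Sum>w'\<in>Poly_Mapping.keys p'.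
      free_eval scale v (?m p w) * free_eval scale v (?m p' w'))"
    by (simp add: free_eval_sum single)
  also have "\<dots> = (\<Sum>w\<in>Poly_Mapping.keys p. free_eval scale v (?m p w)) *
      (\<Sum>w'\<in>Poly_Mapping.keys p'. free_eval scale v (?m p' w'))"
    by (rule sum_product[symmetric])
  also have "\<dots> = free_eval scale v p * free_eval scale v p'"
    by (simp add: free_eval_sum[symmetric] sum_monomials[symmetric])
  finally show ?thesis .
qed

lemma free_eval_power: "free_eval scale v (p ^ n) = free_eval scale v p ^ n"
  by (induction n) (simp_all add: free_eval_one free_eval_mult)

lemma two_sided_ideal_free_eval_kernel: "two_sided_ideal {p. free_eval scale v p = 0}"
  by (simp add: two_sided_ideal_def free_eval_zero free_eval_add free_eval_mult)

end

definition algebra_hom ::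
  "('k::field \<Rightarrow> 'a::ring_1 \<Rightarrow> 'a) \<Rightarrow> ('k \<Rightarrow> 'b::ring_1 \<Rightarrow> 'b) \<Rightarrow> ('a \<Rightarrow> 'b) \<Rightarrow> bool" where
  "algebra_hom scale scale' h \<longleftrightarrow>
     h 1 = 1 \<and> (\<forall>a b. h (a + b) = h a + h b) \<and> (\<forall>a b. h (a * b) = h a * h b) \<and>
     (\<forall>c a. h (scale c a) = scale' c (h a))"

text \<open>The universal property: evaluation in an algebra that satisfies the relations kills the ideal
  generated by them, hence factors through the presented algebra. A single such algebra with a
  non-zero image is then enough to show that an element of the presented algebra does not vanish.\<close>

lemma presented_algebra_lift:
  assumes pres: "presented_algebra scale v rels"
    and alg: "associative_algebra scale'"
    and rels: "\<And>p. p \<in> rels \<Longrightarrow> free_eval scale' w p = 0"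
  obtains h where "algebra_hom scale scale' h" "\<And>i. h (v i) = w i"
proof -
  interpret S: associative_algebra scale
    using pres by (simp add: presented_algebra_def)
  interpret T: associative_algebra scale' by (rule alg)
  have "two_sided_ideal hull rels \<subseteq> {p. free_eval scale' w p = 0}"
    by (rule hull_minimal) (use rels T.two_sided_ideal_free_eval_kernel in auto)
  then have ker: "free_eval scale' w p = 0" if "free_eval scale v p = 0" for p
    using pres that by (auto simp: presented_algebra_def)
  have surj: "surj (free_eval scale v)"
    using pres by (simp add: presented_algebra_def)
  define h where "h a = free_eval scale' w (inv (free_eval scale v) a)" for a
  have h: "h (free_eval scale v p) = free_eval scale' w p" for p
  proof -
    have "free_eval scale v (inv (free_eval scale v) (free_eval scale v p) - p) = 0"
      by (simp add: S.free_eval_diff surj_f_inv_f[OF surj])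
    from ker[OF this] show ?thesis
      by (simp add: T.free_eval_diff h_def)
  qed
  have lift: "\<exists>p. a = free_eval scale v p" for a
    using surj by (metis surj_def)
  show ?thesis
  proof (rule that[of h])
    have add: "h (a + b) = h a + h b" for a b
      using lift[of a] lift[of b] by (metis h S.free_eval_add T.free_eval_add)
    have mult: "h (a * b) = h a * h b" for a b
      using lift[of a] lift[of b] by (metis h S.free_eval_mult T.free_eval_mult)
    have one: "h 1 = 1"
      by (metis h S.free_eval_one T.free_eval_one)
    have "h (scale c a) = scale' c (h a)" for c a
    proof -
      have "h (scale c 1 * a) = h (scale c 1) * h a"
        by (rule mult)
      moreover have "h (scale c 1) = scale' c 1"
        by (metis h S.free_eval_const T.free_eval_const)
      ultimately show ?thesis
        by (simp add: S.scale_mult_left T.scale_mult_left)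
    qed
    with add mult one show "algebra_hom scale scale' h"
      by (simp add: algebra_hom_def)
    show "h (v i) = w i" for i
      by (metis h S.free_eval_gen T.free_eval_gen)
  qed
qed

section \<open>Linear operators on sequences\<close>

text \<open>The operators form a type of their own because the free algebra is evaluated in ring types.\<close>

typedef (overloaded) 'k seq_endo =
  "{T :: (nat \<Rightarrow> 'k::field) \<Rightarrow> nat \<Rightarrow> 'k.
     (\<forall>f f'. T (\<lambda>n. f n + f' n) = (\<lambda>n. T f n + T f' n)) \<and>
     (\<forall>c f. T (\<lambda>n. c * f n) = (\<lambda>n. c * T f n))}"
  morphisms seq_apply Abs_seq_endo
  by (rule exI[of _ "\<lambda>f. f"]) simp

setup_lifting type_definition_seq_endo

instantiation seq_endo :: (field) ring_1
begin

lift_definition zero_seq_endo :: "'a seq_endo" is "\<lambda>f n. 0" by simp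
lift_definition one_seq_endo :: "'a seq_endo" is "\<lambda>f. f" by simp
lift_definition plus_seq_endo :: "'a seq_endo \<Rightarrow> 'a seq_endo \<Rightarrow> 'a seq_endo"
  is "\<lambda>S T f n. S f n + T f n" by (simp add: algebra_simps)
lift_definition uminus_seq_endo :: "'a seq_endo \<Rightarrow> 'a seq_endo"
  is "\<lambda>T f n. - T f n" by simp
lift_definition minus_seq_endo :: "'a seq_endo \<Rightarrow> 'a seq_endo \<Rightarrow> 'a seq_endo"
  is "\<lambda>S T f n. S f n - T f n" by (simp add: algebra_simps)
lift_definition times_seq_endo :: "'a seq_endo \<Rightarrow> 'a seq_endo \<Rightarrow> 'a seq_endo"
  is "\<lambda>S T f. S (T f)" by simp

instance
proof
  show "(0 :: 'a seq_endo) \<noteq> 1"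
    by transfer (metis zero_neq_one)
qed (transfer; simp add: fun_eq_iff algebra_simps)+

end

lift_definition scale_seq_endo :: "'k::field \<Rightarrow> 'k seq_endo \<Rightarrow> 'k seq_endo"
  is "\<lambda>c T f n. c * T f n" by (simp add: algebra_simps)

lemma associative_algebra_seq_endo: "associative_algebra scale_seq_endo"
  by unfold_locales (transfer; simp add: fun_eq_iff algebra_simps)+

lemma seq_apply_sum: "seq_apply (sum T S) f n = (\<Sum>i\<in>S. seq_apply (T i) f n)"
  by (induction S rule: infinite_finite_induct)
    (simp_all add: zero_seq_endo.rep_eq plus_seq_endo.rep_eq)

lift_definition shift_endo :: "nat \<Rightarrow> 'k::field seq_endo"
  is "\<lambda>N f n. if 0 < n \<and> n < N then f (n - 1) else 0" by (simp add: fun_eq_iff)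

lift_definition diagonal_endo :: "(nat \<Rightarrow> 'k::field) \<Rightarrow> 'k seq_endo"
  is "\<lambda>d f n. d n * f n" by (simp add: fun_eq_iff algebra_simps)

lemma shift_endo_power:
  "seq_apply (shift_endo N ^ Suc m) f n = (if m < n \<and> n < N then f (n - Suc m) else 0)"
proof (induction m arbitrary: n)
  case 0
  then show ?case by (simp add: shift_endo.rep_eq)
next
  case (Suc m)
  show ?case
    by (subst power_Suc, unfold times_seq_endo.rep_eq shift_endo.rep_eq Suc.IH) auto
qed

lemma diagonal_endo_power: "seq_apply (diagonal_endo d ^ m) f n = d n ^ m * f n"
  by (induction m arbitrary: n)
    (simp_all add: one_seq_endo.rep_eq times_seq_endo.rep_eq diagonal_endo.rep_eq)

lemma seq_endo_eqI: "(\<And>f n. seq_apply S f n = seq_apply T f n) \<Longrightarrow> S = T"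
  by (metis ext seq_apply_inject)

text \<open>On the first \<open>N\<close> entries of a sequence, the coefficients of a polynomial modulo \<open>x^N\<close>, the shift
  is multiplication by \<open>x\<close>. The constant polynomial is an eigenvector of \<open>g\<close> with eigenvalue \<open>\<omega>\<close>,
  which forces the other eigenvalues of \<open>g\<close> to be \<open>\<omega> * q ^ n\<close>.\<close>

lemma taft_relations_seq_endo:
  fixes q \<omega> :: "'k::field"
  assumes N: "0 < N" and q: "q ^ N = 1" and \<omega>: "\<omega> ^ N = 1" and p: "p \<in> taft_relations N q"
  shows "free_eval scale_seq_endo
    (case_taft_gen (diagonal_endo (\<lambda>n. \<omega> * q ^ n)) (shift_endo N)) p = 0"
proof -
  interpret associative_algebra "scale_seq_endo :: 'k \<Rightarrow> _"
    by (rule associative_algebra_seq_endo)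
  let ?G = "diagonal_endo (\<lambda>n. \<omega> * q ^ n)" and ?X = "shift_endo N :: 'k seq_endo"
  note eval = free_eval_diff free_eval_power free_eval_gen free_eval_one free_eval_mult
    free_eval_const
  have G: "?G ^ N = 1"
  proof (rule seq_endo_eqI)
    fix f n
    have "(\<omega> * q ^ n) ^ N = 1"
      by (metis \<omega> power_commutes power_mult power_mult_distrib power_one q mult.commute mult_1)
    then show "seq_apply (?G ^ N) f n = seq_apply 1 f n"
      by (simp add: diagonal_endo_power one_seq_endo.rep_eq)
  qed
  have X: "?X ^ N = 0"
  proof (rule seq_endo_eqI)
    fix f n
    obtain m where "N = Suc m" using N by (cases N) auto
    then show "seq_apply (?X ^ N) f n = seq_apply 0 f n"
      by (auto simp: shift_endo_power zero_seq_endo.rep_eq simp del: power_Suc)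
  qed
  have GX: "?G * ?X = scale_seq_endo q 1 * ?X * ?G"
  proof (rule seq_endo_eqI)
    fix f n
    show "seq_apply (?G * ?X) f n = seq_apply (scale_seq_endo q 1 * ?X * ?G) f n"
      by (cases n) (simp_all add: times_seq_endo.rep_eq diagonal_endo.rep_eq shift_endo.rep_eq
          scale_seq_endo.rep_eq one_seq_endo.rep_eq)
  qed
  show ?thesis
    using p unfolding taft_relations_def by (auto simp: eval G X GX)
qed

section \<open>Roots of unity\<close>

lemma primitive_root_power_eq_1_iff:
  assumes "primitive_root_of_unity N q" "0 < N"
  shows "q ^ n = 1 \<longleftrightarrow> N dvd n"
proof
  assume "q ^ n = 1"
  have "q ^ n = (q ^ N) ^ (n div N) * q ^ (n mod N)"
    by (metis mult_div_mod_eq power_add power_mult)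
  then have "q ^ (n mod N) = 1"
    using assms \<open>q ^ n = 1\<close> by (simp add: primitive_root_of_unity_def)
  then have "n mod N = 0"
    using assms by (metis mod_less_divisor primitive_root_of_unity_def neq0_conv)
  then show "N dvd n" by auto
qed (use assms in \<open>auto simp: primitive_root_of_unity_def power_mult\<close>)

lemma primitive_root_nonzero: "primitive_root_of_unity N q \<Longrightarrow> 0 < N \<Longrightarrow> q \<noteq> 0"
  by (auto simp: primitive_root_of_unity_def power_0_left)

lemma primitive_root_powi_eq_1_iff:
  assumes "primitive_root_of_unity N q" "0 < N"
  shows "q powi k = 1 \<longleftrightarrow> int N dvd k"
proof (cases "k \<ge> 0")
  case True
  then have "q powi k = q ^ nat k" and "int N dvd k \<longleftrightarrow> N dvd nat k"
    by (simp_all add: power_int_def) (metis int_dvd_int_iff int_nat_eq)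
  then show ?thesis by (simp add: primitive_root_power_eq_1_iff[OF assms])
next
  case False
  then have "q powi k = inverse (q ^ nat (- k))" and "int N dvd k \<longleftrightarrow> N dvd nat (- k)"
    by (simp_all add: power_int_def power_inverse)
      (metis int_dvd_int_iff int_nat_eq dvd_minus_iff neg_0_le_iff_le linear)
  then show ?thesis by (simp add: primitive_root_power_eq_1_iff[OF assms])
qed

lemma geometric_sum_root_of_unity:
  fixes z :: "'k::field"
  assumes "z ^ N = 1" "z \<noteq> 1"
  shows "(\<Sum>i<N. z ^ i) = 0"
  using assms by (simp add: sum_gp_strict)

text \<open>If \<open>N\<close> vanished in the field, then \<open>1 + z + \<dots> + z^(N - 1)\<close> would vanish at \<open>z = 1\<close> as well
  as at the other \<open>N - 1\<close> powers of \<open>q\<close>: one root too many for its degree.\<close>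

lemma primitive_root_of_nat_nonzero:
  fixes q :: "'k::field"
  assumes q: "primitive_root_of_unity N q" and N: "0 < N"
  shows "(of_nat N :: 'k) \<noteq> 0"
proof
  assume 0: "(of_nat N :: 'k) = 0"
  define p :: "'k poly" where "p = (\<Sum>i<N. monom 1 i)"
  have poly_p: "poly p z = (\<Sum>i<N. z ^ i)" for z
    by (simp add: p_def poly_sum poly_monom)
  have "coeff p 0 = 1"
    using N by (simp add: p_def coeff_sum)
  then have "p \<noteq> 0" by auto
  have deg: "degree p \<le> N - 1"
    unfolding p_def by (rule degree_sum_le) (auto simp: degree_monom_eq)
  have qN: "q ^ N = 1" and q0: "q \<noteq> 0"
    using q primitive_root_nonzero[OF q N] by (auto simp: primitive_root_of_unity_def)
  have inj: "inj_on (\<lambda>i. q ^ i) {..<N}"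
  proof -
    have False if "i < j" "j < N" "q ^ i = q ^ j" for i j
    proof -
      have "q ^ i * q ^ (j - i) = q ^ i * 1"
        using that by (metis power_add le_add_diff_inverse less_imp_le mult_1_right)
      then have "q ^ (j - i) = 1" using q0 by simp
      then show False
        using that q by (auto simp: primitive_root_of_unity_def)
    qed
    then show ?thesis by (intro inj_onI) (metis lessThan_iff nat_neq_iff)
  qed
  have "(\<lambda>i. q ^ i) ` {..<N} \<subseteq> {z. poly p z = 0}"
  proof clarify
    fix i
    have "(q ^ i) ^ N = 1"
      by (metis mult.commute power_mult power_one qN)
    then show "poly p (q ^ i) = 0"
      using geometric_sum_root_of_unity[of "q ^ i" N] 0 by (cases "q ^ i = 1") (auto simp: poly_p)
  qed
  then have "card ((\<lambda>i. q ^ i) ` {..<N}) \<le> card {z. poly p z = 0}"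
    using poly_roots_finite[OF \<open>p \<noteq> 0\<close>] by (rule card_mono[rotated])
  also have "\<dots> \<le> N - 1"
    using card_poly_roots_bound[OF \<open>p \<noteq> 0\<close>] deg by simp
  finally show False
    using N by (simp add: card_image[OF inj])
qed

section \<open>The idempotents of the Taft algebra\<close>

locale taft = associative_algebra scale
  for scale :: "'k::field \<Rightarrow> 'a::ring_1 \<Rightarrow> 'a" (infixr "*s" 75) +
  fixes N :: nat and q :: 'k and g x :: 'a
  assumes N_ge_2: "2 \<le> N"
    and q_primitive: "primitive_root_of_unity N q"
    and presented: "taft_algebra scale N q g x"
begin

abbreviation e :: "int \<Rightarrow> 'a" where
  "e \<equiv> taft_e scale N q g"

abbreviation R :: "'a set" where
  "R \<equiv> taft_R scale x"

lemma N_pos: "0 < N"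
  using N_ge_2 by simp

lemma of_nat_N_nonzero: "(of_nat N :: 'k) \<noteq> 0"
  using q_primitive N_pos by (rule primitive_root_of_nat_nonzero)

lemma q_nonzero: "q \<noteq> 0"
  using primitive_root_nonzero q_primitive N_pos by blast

lemma q_power_N: "q ^ N = 1"
  using q_primitive by (simp add: primitive_root_of_unity_def)

lemma q_powi_eq_1_iff: "q powi k = 1 \<longleftrightarrow> int N dvd k"
  using primitive_root_powi_eq_1_iff q_primitive N_pos by blast

lemma powi_root_of_unity: "(q powi k) ^ N = 1"
  using q_powi_eq_1_iff[of "k * int N"] by (simp add: power_int_mult)

lemma root_sum: "(\<Sum>i<N. (q powi k) ^ i) = (if int N dvd k then of_nat N else 0)"
  using geometric_sum_root_of_unity[OF powi_root_of_unity[of k]] q_powi_eq_1_iff[of k] by auto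

lemma e_eq: "e t = (1 / of_nat N) *s (\<Sum>i<N. (q powi t) ^ i *s g ^ i)"
proof -
  have "{0..N - 1} = {..<N}" using N_pos by auto
  then show ?thesis
    by (simp add: taft_e_def power_int_mult)
qed

lemma relation_vanishes: "p \<in> taft_relations N q \<Longrightarrow> free_eval scale (case_taft_gen g x) p = 0"
  using presented hull_subset[of "taft_relations N q" two_sided_ideal]
  unfolding taft_algebra_def presented_algebra_def by blast

lemma g_power_N: "g ^ N = 1"
  using relation_vanishes[of "free_gen Gen_g ^ N - 1"]
  by (simp add: taft_relations_def free_eval_diff free_eval_power free_eval_gen free_eval_one)

lemma x_power_N: "x ^ N = 0"
  using relation_vanishes[of "free_gen Gen_x ^ N"]
  by (simp add: taft_relations_def free_eval_power free_eval_gen)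

lemma x_power_eq_0: "N \<le> n \<Longrightarrow> x ^ n = 0"
  by (metis le_add_diff_inverse mult_zero_left power_add x_power_N)

lemma g_x: "g * x = q *s (x * g)"
  using relation_vanishes[of "free_gen Gen_g * free_gen Gen_x
    - free_const q * free_gen Gen_x * free_gen Gen_g"]
  by (simp add: taft_relations_def free_eval_diff free_eval_mult free_eval_gen free_eval_const
      scale_mult_left)

lemma g_power_x: "g ^ i * x = q ^ i *s (x * g ^ i)"
proof (induction i)
  case (Suc i)
  have "g ^ Suc i * x = g * (g ^ i * x)"
    by (simp add: mult.assoc)
  also have "\<dots> = q ^ i *s ((g * x) * g ^ i)"
    by (simp only: Suc scale_mult_right mult.assoc)
  also have "\<dots> = q ^ Suc i *s (x * g ^ Suc i)"
    by (simp add: g_x scale_mult_left mult.assoc mult.commute)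
  finally show ?case .
qed simp

lemma g_e: "g * e t = q powi (- t) *s e t"
proof -
  let ?F = "\<lambda>i. (q powi t) ^ i *s g ^ i"
  have inv: "q powi (- t) * q powi t = 1"
    using q_nonzero by (simp add: power_int_minus)
  have step: "g * ?F i = q powi (- t) *s ?F (Suc i)" for i
    using inv by (simp add: scale_mult_right mult.assoc[symmetric])
  have "(\<Sum>i<N. ?F (Suc i)) + ?F 0 = (\<Sum>i<N. ?F i) + ?F N"
    using sum.lessThan_Suc_shift[of ?F N] by (simp add: add.commute)
  moreover have "?F N = ?F 0"
    by (simp only: g_power_N powi_root_of_unity power_0)
  ultimately have cyc: "(\<Sum>i<N. ?F (Suc i)) = (\<Sum>i<N. ?F i)"
    by simp
  have "g * e t = (1 / of_nat N) *s (\<Sum>i<N. g * ?F i)"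
    by (simp only: e_eq scale_mult_right sum_distrib_left)
  also have "\<dots> = (1 / of_nat N) *s (q powi (- t) *s (\<Sum>i<N. ?F (Suc i)))"
    by (simp only: step scale_sum_right)
  also have "\<dots> = q powi (- t) *s e t"
    by (simp only: cyc e_eq scale_scale mult.commute)
  finally show ?thesis .
qed

lemma e_cong:
  assumes "s mod int N = t mod int N"
  shows "e s = e t"
proof -
  have "q powi (s - t) = 1"
    using assms by (simp add: q_powi_eq_1_iff mod_eq_dvd_iff)
  then have "q powi s = q powi t"
    using q_nonzero by (simp add: power_int_diff)
  then show ?thesis by (simp add: e_eq)
qed

lemma e_mult_e: "e s * e t = (if s mod int N = t mod int N then e t else 0)"
proof -
  have g_power_e: "g ^ i * e t = (q powi (- t)) ^ i *s e t" for i
    by (induction i) (simp_all add: mult.assoc scale_mult_right g_e mult.commute)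
  have "e s * e t = (1 / of_nat N) *s ((\<Sum>i<N. (q powi s) ^ i * (q powi (- t)) ^ i) *s e t)"
    by (subst e_eq) (simp add: scale_mult_left sum_distrib_right g_power_e scale_sum_left)
  also have "(\<Sum>i<N. (q powi s) ^ i * (q powi (- t)) ^ i) = (\<Sum>i<N. (q powi (s - t)) ^ i)"
    using q_nonzero by (simp add: power_mult_distrib[symmetric] power_int_add[symmetric])
  also have "\<dots> = (if s mod int N = t mod int N then of_nat N else 0)"
    by (simp add: root_sum mod_eq_dvd_iff)
  finally show ?thesis
    using of_nat_N_nonzero by simp
qed

lemma e_idem: "e s * e s = e s"
  by (simp add: e_mult_e)

lemma sum_e: "(\<Sum>s<N. e (int s)) = 1"
proof -
  have "(\<Sum>s<N. e (int s)) = (1 / of_nat N) *s (\<Sum>s<N. \<Sum>i<N. (q powi int s) ^ i *s g ^ i)"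
    by (simp add: e_eq scale_sum_right)
  also have "(\<Sum>s<N. \<Sum>i<N. (q powi int s) ^ i *s g ^ i) =
      (\<Sum>i<N. (\<Sum>s<N. (q powi int i) ^ s) *s g ^ i)"
    by (subst sum.swap) (simp add: scale_sum_left power_mult[symmetric] mult.commute)
  also have "\<dots> = (\<Sum>i<N. if i = 0 then of_nat N *s 1 else 0)"
    by (rule sum.cong) (use root_sum in \<open>auto simp del: power_int_of_nat dest: dvd_imp_le\<close>)
  also have "\<dots> = of_nat N *s 1"
    using N_pos by (simp add: sum.delta)
  finally show ?thesis
    using of_nat_N_nonzero by simp
qed

lemma e_x: "e s * x = x * e (s + 1)"
  using q_nonzero by (simp add: e_eq scale_mult_left scale_mult_right sum_distrib_left
      sum_distrib_right g_power_x power_int_add power_mult_distrib)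

lemma e_x_power: "e s * x ^ n = x ^ n * e (s + int n)"
proof (induction n)
  case (Suc n)
  have "e s * x ^ Suc n = (e s * x ^ n) * x"
    by (simp only: power_Suc2 mult.assoc)
  also have "\<dots> = x ^ n * (e (s + int n) * x)"
    by (simp only: Suc mult.assoc)
  also have "\<dots> = x ^ Suc n * e (s + int (Suc n))"
    by (simp only: e_x power_Suc2 mult.assoc) (simp add: algebra_simps)
  finally show ?case .
qed simp

lemma x_power_e: "x ^ n * e s = e (s - int n) * x ^ n"
  by (simp add: e_x_power)

text \<open>The defining relations bound the algebra from above; a model is needed to see that the
  longest paths survive. If \<open>g\<close> multiplies the zeroth entry of a sequence by \<open>q powi (- s)\<close>, then
  \<open>e s\<close> fixes that entry, and \<open>x ^ (N - 1)\<close> moves it to position \<open>N - 1\<close>.\<close>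

lemma x_power_pred_e_nonzero: "x ^ (N - 1) * e s \<noteq> 0"
proof
  assume vanish: "x ^ (N - 1) * e s = 0"
  let ?G = "diagonal_endo (\<lambda>n. q powi (- s) * q ^ n)" and ?X = "shift_endo N :: 'k seq_endo"
  obtain h :: "'a \<Rightarrow> 'k seq_endo" where
    hom: "algebra_hom scale scale_seq_endo h"
    and gens: "\<And>i. h (case_taft_gen g x i) = case_taft_gen ?G ?X i"
    using presented_algebra_lift[OF presented[unfolded taft_algebra_def]
        associative_algebra_seq_endo taft_relations_seq_endo[OF N_pos q_power_N
          powi_root_of_unity[of "- s"]]] by blast
  have one: "h 1 = 1" and add: "h (a + b) = h a + h b" and mult: "h (a * b) = h a * h b"
    and scl: "h (c *s a) = scale_seq_endo c (h a)" for a b c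
    using hom by (simp_all add: algebra_hom_def)
  have g: "h g = ?G" and x: "h x = ?X"
    using gens[of Gen_g] gens[of Gen_x] by simp_all
  have zero: "h 0 = 0"
    using add[of 0 0] by simp
  have power: "h (a ^ n) = h a ^ n" for a n
    by (induction n) (simp_all add: one mult)
  have sum: "h (sum a S) = (\<Sum>i\<in>S. h (a i))" for a :: "nat \<Rightarrow> 'a" and S
    by (induction S rule: infinite_finite_induct) (simp_all add: zero add)
  define \<delta> :: "nat \<Rightarrow> 'k" where "\<delta> n = (if n = 0 then 1 else 0)" for n
  have "seq_apply (h (e s)) \<delta> 0 =
      (1 / of_nat N) * (\<Sum>i<N. (q powi s) ^ i * (q powi (- s)) ^ i)"
    by (simp add: e_eq scl sum power g seq_apply_sum scale_seq_endo.rep_eq diagonal_endo_power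
        \<delta>_def)
  also have "\<dots> = 1"
    using q_nonzero of_nat_N_nonzero
    by (simp add: power_mult_distrib[symmetric] power_int_minus)
  finally have "seq_apply (h (e s)) \<delta> 0 = 1" .
  moreover have "seq_apply (?X ^ (N - 1)) f (N - 1) = f 0" for f
  proof -
    obtain m where "N = Suc (Suc m)"
      using N_ge_2 by (metis Suc_le_D numeral_2_eq_2 Suc_le_mono)
    then show ?thesis by (simp add: shift_endo_power del: power_Suc)
  qed
  ultimately have "seq_apply (h (x ^ (N - 1) * e s)) \<delta> (N - 1) = 1"
    by (simp add: mult power x times_seq_endo.rep_eq)
  then show False
    unfolding vanish by (simp add: zero zero_seq_endo.rep_eq)
qed

text \<open>The span of the paths contains \<open>1\<close> and is stable under left multiplication by both generators:
  \<open>x\<close> lengthens a path and \<open>g\<close> multiplies it by a power of \<open>q\<close>.\<close>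

lemma span_x_power_e: "a \<in> span (range (\<lambda>(n, t). x ^ n * e t))"
proof -
  let ?B = "range (\<lambda>(n, t). x ^ n * e t)"
  have basis: "x ^ n * e t \<in> span ?B" for n t
    by (rule span_base) auto
  have word: "prod_list (map (case_taft_gen g x) ws) \<in> span ?B" for ws
  proof (induction ws)
    case Nil
    have "(\<Sum>s<N. x ^ 0 * e (int s)) \<in> span ?B"
      by (intro span_sum basis)
    then show ?case by (simp add: sum_e)
  next
    case (Cons y ws)
    have "case_taft_gen g x y * b \<in> span ?B" if "b \<in> span ?B" for b
      using that
    proof (induction rule: span_induct_alt)
      case (step c b1 b2)
      then obtain n t where b1: "b1 = x ^ n * e t" by auto
      have "case_taft_gen g x y * b1 \<in> span ?B"
      proof (cases y)
        case Gen_x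
        then show ?thesis
          using basis[of "Suc n" t] by (simp add: b1 mult.assoc)
      next
        case Gen_g
        have "g * b1 = g * e (t - int n) * x ^ n"
          by (simp add: b1 x_power_e mult.assoc)
        also have "\<dots> = q powi (- (t - int n)) *s (x ^ n * e t)"
          by (simp only: g_e scale_mult_left x_power_e)
        finally show ?thesis
          using Gen_g basis span_scale by simp
      qed
      then show ?case
        using step by (simp add: distrib_left scale_mult_right span_add span_scale)
    qed (simp add: span_zero)
    then show ?case using Cons by simp
  qed
  have "surj (free_eval scale (case_taft_gen g x))"
    using presented by (simp add: taft_algebra_def presented_algebra_def)
  then obtain p where "a = free_eval scale (case_taft_gen g x) p"
    by (metis surj_def)
  then show ?thesis
    unfolding free_eval_def by (auto intro!: span_sum span_scale word)
qed

end

section \<open>Right ideals\<close>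

lemma right_ideal_zero: "right_ideal I \<Longrightarrow> 0 \<in> I"
  and right_ideal_add: "right_ideal I \<Longrightarrow> a \<in> I \<Longrightarrow> b \<in> I \<Longrightarrow> a + b \<in> I"
  and right_ideal_mult: "right_ideal I \<Longrightarrow> a \<in> I \<Longrightarrow> a * r \<in> I"
  by (auto simp: right_ideal_def)

lemma right_ideal_diff:
  assumes "right_ideal I" "a \<in> I" "b \<in> I"
  shows "a - b \<in> I"
  using right_ideal_add[OF assms(1,2) right_ideal_mult[OF assms(1,3), of "- 1"]] by simp

lemma right_ideal_sum:
  assumes "right_ideal I" "\<And>i. i \<in> S \<Longrightarrow> f i \<in> I"
  shows "sum f S \<in> I"
  using assms(2)
  by (induction S rule: infinite_finite_induct)
    (auto intro: right_ideal_zero right_ideal_add assms(1))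

lemma right_ideal_range: "right_ideal (range ((*) (y :: 'a::ring_1)))"
  unfolding right_ideal_def
  by (auto simp: image_iff mult.assoc intro: exI[of _ 0] exI[of _ "_ + _"] distrib_left[symmetric])

lemma right_ideal_set_plus:
  assumes J: "right_ideal J" and K: "right_ideal K"
  shows "right_ideal {a + b | a b. a \<in> J \<and> b \<in> K}"
  unfolding right_ideal_def
proof (intro conjI ballI allI)
  show "0 \<in> {a + b | a b. a \<in> J \<and> b \<in> K}"
    using right_ideal_zero[OF J] right_ideal_zero[OF K] by force
next
  fix y z
  assume "y \<in> {a + b | a b. a \<in> J \<and> b \<in> K}" "z \<in> {a + b | a b. a \<in> J \<and> b \<in> K}"
  then obtain a b a' b' where "y = a + b" "z = a' + b'" "a \<in> J" "b \<in> K" "a' \<in> J" "b' \<in> K"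
    by auto
  moreover have "(a + b) + (a' + b') = (a + a') + (b + b')"
    by (simp add: algebra_simps)
  ultimately show "y + z \<in> {a + b | a b. a \<in> J \<and> b \<in> K}"
    using right_ideal_add[OF J, of a a'] right_ideal_add[OF K, of b b'] by blast
next
  fix y r
  assume "y \<in> {a + b | a b. a \<in> J \<and> b \<in> K}"
  then obtain a b where "y = a + b" "a \<in> J" "b \<in> K" by auto
  then show "y * r \<in> {a + b | a b. a \<in> J \<and> b \<in> K}"
    using right_ideal_mult[OF J, of a r] right_ideal_mult[OF K, of b r] distrib_right[of a b r]
    by blast
qed

text \<open>Two non-zero direct summands would share the element \<open>w\<close>.\<close>

lemma indecomposable_if_essential_element:
  fixes I :: "'a::ring_1 set"
  assumes I: "right_ideal I" and w: "w \<in> I" "w \<noteq> 0"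
    and essential: "\<And>z. z \<in> I \<Longrightarrow> z \<noteq> 0 \<Longrightarrow> \<exists>a. z * a = w"
  shows "indecomposable_right_ideal I"
  unfolding indecomposable_right_ideal_def
proof (intro conjI allI impI)
  fix J K
  assume JK: "right_ideal J \<and> right_ideal K \<and> J \<inter> K = {0} \<and>
    I = {a + b | a b. a \<in> J \<and> b \<in> K}"
  then have J: "right_ideal J" and K: "right_ideal K" by auto
  have w_in: "w \<in> L" if L: "right_ideal L" "L \<subseteq> I" "L \<noteq> {0}" for L
  proof -
    obtain z where "z \<in> L" "z \<noteq> 0"
      using L right_ideal_zero[OF L(1)] by auto
    then show ?thesis
      using essential[of z] L right_ideal_mult[OF L(1), of z] by auto
  qed
  have "J \<subseteq> I"
    using JK right_ideal_zero[OF K] by force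
  moreover have "K \<subseteq> I"
    using JK right_ideal_zero[OF J] by force
  ultimately show "J = {0} \<or> K = {0}"
    using w_in[of J] w_in[of K] J K JK w(2) by auto
qed (use I w in auto)

lemma right_module_isomorphic_annihilator:
  assumes iso: "right_module_isomorphic I J" and I: "right_ideal I"
  shows "(\<forall>z\<in>I. z * a = 0) \<longleftrightarrow> (\<forall>z\<in>J. z * a = 0)"
proof -
  obtain f where f: "bij_betw f I J"
    and add: "\<And>a b. a \<in> I \<Longrightarrow> b \<in> I \<Longrightarrow> f (a + b) = f a + f b"
    and mult: "\<And>a r. a \<in> I \<Longrightarrow> f (a * r) = f a * r"
    using iso unfolding right_module_isomorphic_def by blast
  have "f 0 = 0"
    using mult[OF right_ideal_zero[OF I], of 0] by simp
  then have "f z * a = 0 \<longleftrightarrow> z * a = 0" if "z \<in> I" for z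
    using that mult[OF that, of a] bij_betw_imp_inj_on[OF f] right_ideal_mult[OF I that, of a]
      right_ideal_zero[OF I] by (metis inj_onD)
  then show ?thesis
    using bij_betw_imp_surj_on[OF f] by auto
qed

lemma right_module_isomorphic_image_unit:
  assumes "v * u = (1 :: 'a::ring_1)"
  shows "right_module_isomorphic ((*) u ` I) I"
  unfolding right_module_isomorphic_def
proof (intro exI[of _ "(*) v"] conjI)
  have "v * (u * z) = z" for z
    using assms by (metis mult.assoc mult_1)
  then show "bij_betw ((*) v) ((*) u ` I) I"
    by (intro bij_betw_byWitness[where f' = "(*) u"]) auto
qed (auto simp: mult.assoc distrib_left)

context taft
begin

section \<open>The subalgebra generated by x\<close>

lemma subalgebra_R: "subalgebra scale R"
  unfolding taft_R_def by (rule hull_in) (auto simp: subalgebra_def)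

lemma R_one: "1 \<in> R"
  and R_add: "a \<in> R \<Longrightarrow> b \<in> R \<Longrightarrow> a + b \<in> R"
  and R_mult: "a \<in> R \<Longrightarrow> b \<in> R \<Longrightarrow> a * b \<in> R"
  and R_scale: "a \<in> R \<Longrightarrow> c *s a \<in> R"
  using subalgebra_R by (auto simp: subalgebra_def)

lemma R_zero: "0 \<in> R"
  using R_scale[OF R_one, of 0] by simp

lemma R_x: "x \<in> R"
  unfolding taft_R_def by (rule hull_inc) simp

lemma R_x_power: "x ^ n \<in> R"
  by (induction n) (simp_all add: R_one R_mult R_x)

lemma R_induct [consumes 1, case_names gen subalgebra]:
  assumes "r \<in> R" "P x" "subalgebra scale {r. P r}"
  shows "P r"
proof -
  have "r \<in> subalgebra scale hull {x}"
    using assms(1) by (simp only: taft_R_def)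
  then show ?thesis
    by (rule hull_induct) (use assms(2,3) in auto)
qed

lemma R_commute_x: "r \<in> R \<Longrightarrow> r * x = x * r"
proof (induction rule: R_induct)
  case subalgebra
  show ?case
    unfolding subalgebra_def
    by (auto simp: distrib_left distrib_right scale_mult_left scale_mult_right)
      (metis mult.assoc)
qed simp

lemma R_commute:
  assumes "r \<in> R" "r' \<in> R"
  shows "r * r' = r' * r"
  using assms(2)
proof (induction rule: R_induct)
  case subalgebra
  show ?case
    unfolding subalgebra_def
    by (auto simp: distrib_left distrib_right scale_mult_left scale_mult_right)
      (metis mult.assoc)
qed (simp add: R_commute_x assms)

text \<open>The elements of this form are a subalgebra containing \<open>x\<close>.\<close>

lemma R_constant_term: "r \<in> R \<Longrightarrow> \<exists>c. \<exists>r'\<in>R. r = c *s 1 + r' * x"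
proof -
  assume "r \<in> R"
  then have "r \<in> R \<and> (\<exists>c. \<exists>r'\<in>R. r = c *s 1 + r' * x)"
  proof (induction rule: R_induct)
    case gen
    have "x = 0 *s 1 + 1 * x" by simp
    then show ?case using R_x R_one by blast
  next
    case subalgebra
    show ?case
      unfolding subalgebra_def
    proof (intro conjI ballI allI CollectI)
      have "1 = 1 *s 1 + 0 * x" by simp
      then show "\<exists>c. \<exists>r'\<in>R. 1 = c *s 1 + r' * x" using R_zero by blast
    next
      fix a b
      assume "a \<in> {r. r \<in> R \<and> (\<exists>c. \<exists>r'\<in>R. r = c *s 1 + r' * x)}"
        "b \<in> {r. r \<in> R \<and> (\<exists>c. \<exists>r'\<in>R. r = c *s 1 + r' * x)}"
      then obtain c r c' r' where *: "a \<in> R" "b \<in> R" "r \<in> R" "r' \<in> R"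
        "a = c *s 1 + r * x" "b = c' *s 1 + r' * x" by blast
      have "a + b = (c + c') *s 1 + (r + r') * x"
        using * by (simp add: scale_left_distrib distrib_right)
      then show "\<exists>c. \<exists>r'\<in>R. a + b = c *s 1 + r' * x" using * R_add by blast
      have "a * b = (c * c') *s 1 + (a * r' + c' *s r) * x"
        by (simp only: \<open>b = _\<close> distrib_left distrib_right scale_mult_right mult_1_right
            mult.assoc[symmetric] scale_mult_left)
          (simp add: \<open>a = _\<close> scale_right_distrib scale_mult_left mult.commute algebra_simps)
      then show "\<exists>c. \<exists>r'\<in>R. a * b = c *s 1 + r' * x" using * R_add R_mult R_scale by meson
    next
      fix d a
      assume "a \<in> {r. r \<in> R \<and> (\<exists>c. \<exists>r'\<in>R. r = c *s 1 + r' * x)}"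
      then obtain c r where *: "a \<in> R" "r \<in> R" "a = c *s 1 + r * x" by blast
      have "d *s a = (d * c) *s 1 + (d *s r) * x"
        using * by (simp add: scale_right_distrib scale_mult_left)
      then show "\<exists>c. \<exists>r'\<in>R. d *s a = c *s 1 + r' * x" using * R_scale by blast
    qed (auto intro: R_one R_add R_mult R_scale)
  qed
  then show ?thesis by blast
qed

text \<open>Splitting off constant terms repeatedly either reaches a non-zero one or produces ever higher
  powers of \<open>x\<close>, which vanish in the end.\<close>

lemma R_leading_term:
  assumes r: "r \<in> R" and "r \<noteq> 0"
  obtains n c r' where "n < N" "c \<noteq> 0" "r' \<in> R" "r = c *s ((1 + r' * x) * x ^ n)"
proof -
  have "(\<exists>r'\<in>R. r = r' * x ^ k) \<or>
      (\<exists>n<k. \<exists>c. c \<noteq> 0 \<and> (\<exists>r'\<in>R. r = c *s ((1 + r' * x) * x ^ n)))" for k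
  proof (induction k)
    case 0
    then show ?case using r by auto
  next
    case (Suc k)
    then consider (power) r' where "r' \<in> R" "r = r' * x ^ k"
      | (unit) n c r' where "n < k" "c \<noteq> 0" "r' \<in> R" "r = c *s ((1 + r' * x) * x ^ n)"
      by blast
    then show ?case
    proof cases
      case power
      obtain c s where s: "s \<in> R" "r' = c *s 1 + s * x"
        using R_constant_term[OF \<open>r' \<in> R\<close>] by blast
      show ?thesis
      proof (cases "c = 0")
        case True
        then have "r = s * x ^ Suc k"
          using power s by (simp add: mult.assoc)
        then show ?thesis using s by blast
      next
        case False
        then have "r = c *s ((1 + (inverse c *s s) * x) * x ^ k)"
          using power s by (simp add: distrib_right scale_mult_left scale_right_distrib)
        then show ?thesis
          using False R_scale[OF \<open>s \<in> R\<close>] by (metis lessI)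
      qed
    next
      case unit
      then show ?thesis by (metis less_SucI)
    qed
  qed
  from this[of N] show ?thesis
    using that \<open>r \<noteq> 0\<close> by (auto simp: x_power_N)
qed

text \<open>The inverse is a geometric series, which is finite because \<open>r * x\<close> is nilpotent.\<close>

lemma unit_one_plus:
  assumes r: "r \<in> R"
  obtains v where "v * (1 + r * x) = 1" "(1 + r * x) * v = 1"
proof -
  have power: "\<exists>r'\<in>R. (r * x) ^ n = r' * x ^ n" for n
  proof (induction n)
    case (Suc n)
    then obtain r' where r': "r' \<in> R" "(r * x) ^ n = r' * x ^ n" by blast
    have "(r * x) ^ Suc n = r * (x * r') * x ^ n"
      using r' by (simp add: mult.assoc)
    also have "\<dots> = (r * r') * x ^ Suc n"
      by (simp add: R_commute_x[OF \<open>r' \<in> R\<close>, symmetric] mult.assoc)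
    finally show ?case using R_mult[OF r \<open>r' \<in> R\<close>] by blast
  qed (use R_one in auto)
  define y where "y = - (r * x)"
  have "y ^ N = 0"
    using power[of N] by (auto simp: y_def power_minus[of "r * x"] x_power_N)
  have "(1 - y) * (\<Sum>i<n. y ^ i) = 1 - y ^ n" for n
    by (induction n) (simp_all add: distrib_left left_diff_distrib)
  moreover have "(\<Sum>i<n. y ^ i) * (1 - y) = 1 - y ^ n" for n
  proof (induction n)
    case (Suc n)
    have "(\<Sum>i<Suc n. y ^ i) * (1 - y) = (1 - y ^ n) + y ^ n * (1 - y)"
      by (simp only: sum.lessThan_Suc distrib_right Suc)
    then show ?case by (simp add: right_diff_distrib power_commutes)
  qed simp
  ultimately show ?thesis
    using that[of "\<Sum>i<N. y ^ i"] \<open>y ^ N = 0\<close> by (simp add: y_def)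
qed

text \<open>For every length exactly one path ends, and exactly one starts, at a given vertex; so next to an
  idempotent the coefficients may be taken from the polynomials in \<open>x\<close>.\<close>

lemma mult_e_in_R:
  obtains r where "r \<in> R" "a * e t = r * e t"
proof -
  have "\<exists>r\<in>R. a * e t = r * e t"
    using span_x_power_e[of a]
  proof (induction rule: span_induct_alt)
    case base
    then show ?case using R_zero by force
  next
    case (step c b a)
    then obtain r n s where r: "r \<in> R" "a * e t = r * e t" and b: "b = x ^ n * e s" by auto
    let ?p = "if s mod int N = t mod int N then x ^ n else 0"
    have "(c *s b + a) * e t = (c *s ?p + r) * e t"
      by (simp add: b r distrib_right scale_mult_left mult.assoc e_mult_e)
    moreover have "c *s ?p + r \<in> R"
      using r by (auto intro!: R_add R_scale R_x_power R_zero)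
    ultimately show ?case by blast
  qed
  then show ?thesis using that by blast
qed

lemma e_mult_in_R:
  obtains r where "r \<in> R" "e s * a = e s * r"
proof -
  have "\<exists>r\<in>R. e s * a = e s * r"
    using span_x_power_e[of a]
  proof (induction rule: span_induct_alt)
    case base
    then show ?case using R_zero by force
  next
    case (step c b a)
    then obtain r n t where r: "r \<in> R" "e s * a = e s * r" and b: "b = x ^ n * e t" by auto
    let ?p = "if s mod int N = (t - int n) mod int N then x ^ n else 0"
    have "e s * e (t - int n) = (if s mod int N = (t - int n) mod int N then e s else 0)"
      using e_cong[of s "t - int n"] by (simp add: e_mult_e)
    then have "e s * b = e s * ?p"
      by (simp add: b x_power_e mult.assoc[symmetric])
    then have "e s * (c *s b + a) = e s * (c *s ?p + r)"
      by (simp add: r distrib_left scale_mult_right)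
    moreover have "c *s ?p + r \<in> R"
      using r by (auto intro!: R_add R_scale R_x_power R_zero)
    ultimately show ?case by blast
  qed
  then show ?thesis using that by blast
qed

lemma right_ideal_scale: "right_ideal I \<Longrightarrow> a \<in> I \<Longrightarrow> c *s a \<in> I"
  using right_ideal_mult[of I a "c *s 1"] by (simp add: scale_mult_right)

lemma right_idealI:
  assumes zero: "0 \<in> K" and add: "\<And>a b. a \<in> K \<Longrightarrow> b \<in> K \<Longrightarrow> a + b \<in> K"
    and scale: "\<And>c a. a \<in> K \<Longrightarrow> c *s a \<in> K"
    and x: "\<And>a. a \<in> K \<Longrightarrow> a * x \<in> K" and e: "\<And>a t. a \<in> K \<Longrightarrow> a * e t \<in> K"
  shows "right_ideal K"
proof -
  have x_power: "k * x ^ n \<in> K" if "k \<in> K" for k n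
  proof (induction n)
    case (Suc n)
    then show ?case
      using x[of "k * x ^ n"] by (simp add: power_Suc2 mult.assoc del: power_Suc)
  qed (use that in simp)
  have "k * a \<in> K" if "k \<in> K" for k a
    using span_x_power_e[of a]
  proof (induction rule: span_induct_alt)
    case base
    then show ?case using zero by simp
  next
    case (step c b a)
    then obtain n t where "b = x ^ n * e t" by auto
    then have "k * b \<in> K"
      using e[OF x_power[OF \<open>k \<in> K\<close>]] by (simp add: mult.assoc)
    then show ?case
      using step by (simp add: distrib_left scale_mult_right add scale)
  qed
  then show ?thesis using zero add by (simp add: right_ideal_def)
qed

section \<open>The right ideals generated by paths\<close>

lemma path_mult_in_R:
  obtains r where "r \<in> R" "e s * x ^ t * a = e s * x ^ t * r"
proof -
  obtain r where "r \<in> R" "e (s + int t) * a = e (s + int t) * r"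
    by (rule e_mult_in_R)
  then show ?thesis
    using that by (simp add: e_x_power mult.assoc)
qed

lemma taft_N_eq_range: "taft_N scale N q g x s t = range ((*) (e (int s) * x ^ t))"
  unfolding taft_N_def using path_mult_in_R[of "int s" t] by (auto simp: image_iff)

lemma socle_nonzero: "e s * x ^ (N - 1) \<noteq> 0"
  using x_power_pred_e_nonzero by (simp add: e_x_power)

lemma path_nonzero_iff: "e s * x ^ n = 0 \<longleftrightarrow> N \<le> n"
proof
  assume "e s * x ^ n = 0"
  show "N \<le> n"
  proof (rule ccontr)
    assume "\<not> N \<le> n"
    then have "e s * x ^ (N - 1) = e s * x ^ n * x ^ (N - 1 - n)"
      by (simp add: mult.assoc power_add[symmetric])
    then show False
      using \<open>e s * x ^ n = 0\<close> socle_nonzero[of s] by simp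
  qed
qed (simp add: x_power_eq_0)

text \<open>As non-zero scalars and the elements \<open>1 + r * x\<close> are invertible, a non-zero multiple of a path
  generates the same right ideal as a path that is at least as long and starts at the same vertex,
  and this path extends to length \<open>N - 1\<close>.\<close>

lemma path_multiple_reaches_socle:
  assumes "z \<in> range ((*) (e s * x ^ t))" "z \<noteq> 0"
  shows "\<exists>a. z * a = e s * x ^ (N - 1)"
proof -
  obtain r where r: "r \<in> R" "z = e s * x ^ t * r"
    using assms(1) path_mult_in_R[of s t] by (metis imageE)
  then have "r \<noteq> 0" using assms(2) by auto
  then obtain n c r' where *: "c \<noteq> 0" "r' \<in> R" "r = c *s ((1 + r' * x) * x ^ n)"
    using R_leading_term r by metis
  obtain v where v: "(1 + r' * x) * v = 1"
    using unit_one_plus \<open>r' \<in> R\<close> by blast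
  have "1 + r' * x \<in> R"
    using * by (simp add: R_add R_one R_mult R_x)
  then have z: "z = c *s (e s * x ^ (t + n) * (1 + r' * x))"
    using R_commute[OF _ R_x_power, of "1 + r' * x" n]
    by (simp add: r * scale_mult_right power_add mult.assoc)
  have le: "t + n \<le> N - 1"
    using \<open>z \<noteq> 0\<close> z x_power_eq_0[of "t + n"] by (cases "N \<le> t + n") auto
  have "z * (v * (inverse c *s x ^ (N - 1 - (t + n)))) =
      e s * x ^ (t + n) * ((1 + r' * x) * v) * x ^ (N - 1 - (t + n))"
    using \<open>c \<noteq> 0\<close> by (simp add: z scale_mult_left scale_mult_right mult.assoc)
  also have "\<dots> = e s * x ^ (t + n + (N - 1 - (t + n)))"
    by (simp only: v mult_1_right power_add mult.assoc)
  also have "t + n + (N - 1 - (t + n)) = N - 1"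
    using le by simp
  finally show ?thesis by blast
qed

lemma indecomposable_unit_image:
  assumes t: "t < N" and r: "r \<in> R"
  shows "indecomposable_right_ideal ((*) (1 + r * x) ` taft_N scale N q g x s t)"
proof (rule indecomposable_if_essential_element)
  let ?u = "1 + r * x" and ?p = "e (int s) * x ^ t" and ?w = "e (int s) * x ^ (N - 1)"
  obtain v where v: "v * ?u = 1"
    using unit_one_plus[OF r] by blast
  have image: "(*) ?u ` taft_N scale N q g x s t = range ((*) (?u * ?p))"
    by (simp add: taft_N_eq_range image_image mult.assoc)
  show "right_ideal ((*) ?u ` taft_N scale N q g x s t)"
    by (simp add: image right_ideal_range)
  have "?w = ?p * x ^ (N - 1 - t)"
    using t by (simp add: mult.assoc power_add[symmetric])
  then show "?u * ?w \<in> (*) ?u ` taft_N scale N q g x s t"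
    by (simp add: taft_N_eq_range)
  have cancel: "v * (?u * z) = z" for z
    by (simp add: v mult.assoc[symmetric])
  show "?u * ?w \<noteq> 0"
    using cancel[of ?w] socle_nonzero by auto
  show "\<exists>a. z * a = ?u * ?w"
    if z: "z \<in> (*) ?u ` taft_N scale N q g x s t" "z \<noteq> 0" for z
  proof -
    obtain z' where z': "z' \<in> range ((*) ?p)" "z = ?u * z'"
      using z by (auto simp: taft_N_eq_range)
    then have "z' \<noteq> 0" using z(2) by auto
    then obtain a where "z' * a = ?w"
      using path_multiple_reaches_socle[OF z'(1)] by blast
    then have "z * a = ?u * ?w"
      by (simp only: z'(2) mult.assoc)
    then show ?thesis by blast
  qed
qed

lemma indecomposable_taft_N:
  assumes "t < N"
  shows "indecomposable_right_ideal (taft_N scale N q g x s t)"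
  using indecomposable_unit_image[OF assms R_zero, of s] by simp

text \<open>The powers of \<open>x\<close> in the annihilator determine \<open>t\<close>. The paths of length \<open>N - 1 - t\<close> outside the
  annihilator start at the vertex \<open>s + t\<close>, which determines \<open>s\<close>.\<close>

lemma taft_N_eq_if_annihilators_eq:
  assumes bounds: "s < N" "t < N" "s' < N" "t' < N"
    and ann: "\<And>a. (\<forall>z\<in>taft_N scale N q g x s t. z * a = 0) \<longleftrightarrow>
      (\<forall>z\<in>taft_N scale N q g x s' t'. z * a = 0)"
  shows "s = s' \<and> t = t'"
proof
  have gen: "e (int s) * x ^ t \<in> taft_N scale N q g x s t" for s t
    unfolding taft_N_eq_range by (metis mult_1_right rangeI)
  have x_power_ann: "(\<forall>z\<in>taft_N scale N q g x s t. z * x ^ k = 0) \<longleftrightarrow> N \<le> t + k" for s t k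
  proof
    assume "\<forall>z\<in>taft_N scale N q g x s t. z * x ^ k = 0"
    then have "e (int s) * x ^ t * x ^ k = 0"
      using gen[of s t] by blast
    then have "e (int s) * x ^ (t + k) = 0"
      by (simp only: power_add mult.assoc)
    then show "N \<le> t + k" by (simp only: path_nonzero_iff)
  next
    assume "N \<le> t + k"
    then have "e (int s) * x ^ t * r * x ^ k = 0" if "r \<in> R" for r
      using R_commute[OF that R_x_power, of k] x_power_eq_0[of "t + k"]
      by (metis mult.assoc mult_zero_left mult_zero_right power_add)
    then show "\<forall>z\<in>taft_N scale N q g x s t. z * x ^ k = 0"
      unfolding taft_N_def by auto
  qed
  show t: "t = t'"
    using x_power_ann[of s t "N - t"] x_power_ann[of s' t' "N - t"]
      x_power_ann[of s t "N - t'"] x_power_ann[of s' t' "N - t'"]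
      ann[of "x ^ (N - t)"] ann[of "x ^ (N - t')"] bounds by auto
  \<comment> \<open>This path extends \<open>e s' * x ^ t\<close> to a path of length \<open>N - 1\<close>. On the first right ideal it can only
    act through the shortest path \<open>e s * x ^ t\<close>, longer ones being killed.\<close>
  let ?a = "e (int s' + int t) * x ^ (N - 1 - t)"
  have long: "x ^ t * x ^ (N - 1 - t) = x ^ (N - 1)"
    using bounds by (simp add: power_add[symmetric])
  have path_a: "e i * x ^ t * ?a = e i * e (int s') * x ^ (N - 1)" for i
  proof -
    have "e i * x ^ t * ?a = e i * (x ^ t * e (int s' + int t)) * x ^ (N - 1 - t)"
      by (simp only: mult.assoc)
    also have "\<dots> = e i * e (int s') * (x ^ t * x ^ (N - 1 - t))"
      by (simp only: e_x_power[symmetric] mult.assoc)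
    finally show ?thesis by (simp only: long)
  qed
  have "e (int s') * x ^ t * ?a \<noteq> 0"
    unfolding path_a e_idem by (rule socle_nonzero)
  then obtain r where r: "r \<in> R" "e (int s) * x ^ t * r * ?a \<noteq> 0"
    using ann[of ?a] gen[of s' t'] t unfolding taft_N_def by blast
  obtain c r' where r': "r' \<in> R" "r = c *s 1 + r' * x"
    using R_constant_term[OF \<open>r \<in> R\<close>] by blast
  have "e (int s) * x ^ t * (r' * x) * ?a =
      e (int s) * x ^ t * r' * (x ^ 1 * e (int s' + int t)) * x ^ (N - 1 - t)"
    by (simp only: mult.assoc power_one_right)
  also have "\<dots> = e (int s) * x ^ t * r' * e (int s' + int t - 1) * (x * x ^ (N - 1 - t))"
    using x_power_e[of 1 "int s' + int t"] by (simp add: mult.assoc)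
  also have "x * x ^ (N - 1 - t) = x ^ (N - t)"
    using bounds by (simp only: power_Suc[symmetric]) (simp add: Suc_diff_Suc)
  finally have "e (int s) * x ^ t * (r' * x) * ?a =
      e (int s) * x ^ t * r' * e (int s' + int t - 1) * x ^ (N - t)" .
  moreover have "e (int s) * x ^ t * r' * e (int s' + int t - 1) * x ^ (N - t) = 0"
  proof -
    have "e (int s) * x ^ t * (r' * e (int s' + int t - 1)) \<in> taft_N scale N q g x s t"
      by (simp add: taft_N_eq_range)
    then show ?thesis
      using x_power_ann[of s t "N - t"] bounds by (auto simp: mult.assoc)
  qed
  ultimately have "e (int s) * x ^ t * r * ?a = c *s (e (int s) * e (int s') * x ^ (N - 1))"
    by (simp only: r' distrib_left distrib_right scale_mult_left scale_mult_right path_a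
        mult_1_right add_0_right)
  then have "e (int s) * e (int s') \<noteq> 0"
    using r by auto
  then show "s = s'"
    using bounds by (auto simp: e_mult_e split: if_splits)
qed

text \<open>The condition on \<open>y\<close> makes it a polynomial in \<open>x\<close> followed by a single idempotent. Its
  leading term is a path up to a scalar, and the other factor is a unit.\<close>

lemma homogeneous_principal_eq_unit_image:
  assumes y: "y * e j = y" "y \<noteq> 0"
  obtains r s t where "r \<in> R" "s < N" "t < N"
    "range ((*) y) = (*) (1 + r * x) ` taft_N scale N q g x s t"
proof -
  obtain r0 where r0: "r0 \<in> R" "y = r0 * e j"
    using mult_e_in_R[of y j] y(1) by metis
  then have "r0 \<noteq> 0" using y(2) by auto
  then obtain n c r where *: "n < N" "c \<noteq> 0" "r \<in> R" "r0 = c *s ((1 + r * x) * x ^ n)"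
    using R_leading_term r0 by metis
  define s where "s = nat ((j - int n) mod int N)"
  have "s < N"
    using N_pos by (simp add: s_def nat_less_iff)
  have "e (int s) = e (j - int n)"
    using N_pos by (intro e_cong) (simp add: s_def)
  then have y_eq: "y = c *s ((1 + r * x) * (e (int s) * x ^ n))"
    by (simp add: r0 * scale_mult_left mult.assoc x_power_e)
  have "range ((*) y) = range ((*) ((1 + r * x) * (e (int s) * x ^ n)))" (is "?L = ?M")
  proof
    have "y * a = (1 + r * x) * (e (int s) * x ^ n) * (c *s a)" for a
      by (simp add: y_eq scale_mult_left scale_mult_right)
    then show "?L \<subseteq> ?M" by auto
    have "(1 + r * x) * (e (int s) * x ^ n) * a = y * (inverse c *s a)" for a
      using \<open>c \<noteq> 0\<close> by (simp add: y_eq scale_mult_left scale_mult_right)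
    then show "?M \<subseteq> ?L" by auto
  qed
  also have "\<dots> = (*) (1 + r * x) ` taft_N scale N q g x s n"
    by (simp add: taft_N_eq_range image_image mult.assoc)
  finally show ?thesis
    using that * \<open>s < N\<close> by blast
qed

section \<open>Splitting off a longest uniserial right ideal\<close>

lemma homogeneous_component_outside:
  assumes "right_ideal L" "z \<notin> L"
  obtains t where "z * e t \<notin> L"
proof -
  have "(\<Sum>t<N. z * e (int t)) = z"
    by (simp add: sum_distrib_left[symmetric] sum_e)
  then show ?thesis
    using that right_ideal_sum[OF assms(1), of "{..<N}" "\<lambda>t. z * e (int t)"] assms(2) by auto
qed

text \<open>Let \<open>K\<close> be maximal among the right ideals in \<open>I\<close> that meet the one generated by \<open>y\<close> trivially.
  If both together did not fill \<open>I\<close>, some \<open>z\<close> outside would satisfy \<open>z * x = y * r + k\<close> with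
  \<open>k \<in> K\<close>. Because \<open>y\<close> has maximal length, \<open>r\<close> is divisible by \<open>x\<close>; correcting \<open>z\<close> by a multiple
  of \<open>y\<close> moves \<open>z * x\<close> into \<open>K\<close>, and a component of \<open>z\<close> at one vertex then enlarges \<open>K\<close>.\<close>

lemma longest_homogeneous_splits:
  assumes I: "right_ideal I" and kill: "\<And>z. z \<in> I \<Longrightarrow> z * x ^ Suc l = 0"
    and y: "y \<in> I" "y * e j = y" "y * x ^ l \<noteq> 0"
  obtains K where "right_ideal K" "range ((*) y) \<inter> K = {0}"
    "I = {a + b | a b. a \<in> range ((*) y) \<and> b \<in> K}"
proof -
  let ?Y = "range ((*) y)"
  define \<A> where "\<A> = {K. right_ideal K \<and> K \<subseteq> I \<and> ?Y \<inter> K = {0}}"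
  have Y: "right_ideal ?Y" by (rule right_ideal_range)
  have "\<exists>M\<in>\<A>. \<forall>X\<in>\<A>. M \<subseteq> X \<longrightarrow> X = M"
  proof (rule subset_Zorn_nonempty)
    have "right_ideal {0 :: 'a}" by (simp add: right_ideal_def)
    then have "{0} \<in> \<A>"
      using right_ideal_zero[OF I] right_ideal_zero[OF Y] by (auto simp: \<A>_def)
    then show "\<A> \<noteq> {}" by blast
  next
    fix C
    assume "C \<noteq> {}" "subset.chain \<A> C"
    then have C: "\<And>K. K \<in> C \<Longrightarrow> right_ideal K \<and> K \<subseteq> I \<and> ?Y \<inter> K = {0}"
      and chain: "\<And>K L. K \<in> C \<Longrightarrow> L \<in> C \<Longrightarrow> K \<subseteq> L \<or> L \<subseteq> K"
      by (auto simp: \<A>_def subset_chain_def)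
    have "right_ideal (\<Union> C)"
      unfolding right_ideal_def
    proof (intro conjI ballI allI)
      show "0 \<in> \<Union> C"
        using \<open>C \<noteq> {}\<close> C right_ideal_zero by blast
      show "a + b \<in> \<Union> C" if ab: "a \<in> \<Union> C" "b \<in> \<Union> C" for a b
      proof -
        obtain A B where AB: "A \<in> C" "a \<in> A" "B \<in> C" "b \<in> B" using ab by blast
        then have "a + b \<in> A \<or> a + b \<in> B"
          using chain[of A B] C right_ideal_add[of A a b] right_ideal_add[of B a b] by blast
        then show ?thesis using AB by blast
      qed
      show "a * r \<in> \<Union> C" if "a \<in> \<Union> C" for a r
        using that C right_ideal_mult by blast
    qed
    then show "\<Union> C \<in> \<A>"
      using C \<open>C \<noteq> {}\<close> unfolding \<A>_def by auto
  qed
  then obtain K where K: "right_ideal K" "K \<subseteq> I" "?Y \<inter> K = {0}"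
    and max: "\<And>X. right_ideal X \<Longrightarrow> X \<subseteq> I \<Longrightarrow> ?Y \<inter> X = {0} \<Longrightarrow> K \<subseteq> X \<Longrightarrow> X = K"
    unfolding \<A>_def by auto
  define L where "L = {a + b | a b. a \<in> ?Y \<and> b \<in> K}"
  have L: "right_ideal L"
    unfolding L_def using Y K(1) by (rule right_ideal_set_plus)
  have K_L: "K \<subseteq> L"
    using right_ideal_zero[OF Y] unfolding L_def by force
  have Y_L: "?Y \<subseteq> L"
    using right_ideal_zero[OF K(1)] unfolding L_def by force
  have L_I: "L \<subseteq> I"
    using y(1) K(2) unfolding L_def by (auto intro!: right_ideal_add[OF I] right_ideal_mult[OF I])
  have "I \<subseteq> L"
  proof (rule ccontr)
    assume "\<not> I \<subseteq> L"
    then obtain z0 where z0: "z0 \<in> I" "z0 \<notin> L" by blast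
    \<comment> \<open>The last power of \<open>x\<close> that keeps \<open>z0\<close> outside \<open>L\<close> gives \<open>z\<close> outside with \<open>z * x\<close> inside.\<close>
    define n where "n = (LEAST n. z0 * x ^ n \<in> L)"
    have "z0 * x ^ N \<in> L"
      using right_ideal_zero[OF L] by (simp add: x_power_N)
    then have n: "z0 * x ^ n \<in> L"
      unfolding n_def by (rule LeastI)
    with z0 have "n \<noteq> 0" by (cases n) auto
    define z where "z = z0 * x ^ (n - 1)"
    have "z \<notin> L"
      using not_less_Least[of "n - 1" "\<lambda>n. z0 * x ^ n \<in> L"] \<open>n \<noteq> 0\<close>
      by (auto simp: z_def n_def)
    have z: "z \<in> I"
      using z0 I by (auto simp: z_def intro: right_ideal_mult)
    have "z * x \<in> L"
      using n \<open>n \<noteq> 0\<close> by (simp add: z_def mult.assoc power_Suc2[symmetric] del: power_Suc)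
    then obtain a k where k: "k \<in> K" "z * x = y * a + k"
      by (auto simp: L_def)
    obtain r where r: "r \<in> R" "y * a = y * r"
      using e_mult_in_R[of j a] y(2) by (metis mult.assoc)
    obtain c r' where r': "r' \<in> R" "r = c *s 1 + r' * x"
      using R_constant_term[OF r(1)] by blast
    have zx: "z * x = c *s y + y * r' * x + k"
      by (simp add: k r r' distrib_left scale_mult_right mult.assoc)
    \<comment> \<open>As \<open>x ^ Suc l\<close> kills \<open>I\<close>, the equation times \<open>x ^ l\<close> would otherwise put \<open>y * x ^ l\<close> into \<open>K\<close>.\<close>
    have "c = 0"
    proof (rule ccontr)
      assume "c \<noteq> 0"
      have "0 = z * x * x ^ l"
        using kill[OF z] by (simp add: mult.assoc)
      also have "\<dots> = c *s (y * x ^ l) + y * r' * x ^ Suc l + k * x ^ l"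
        by (simp add: zx distrib_right scale_mult_left mult.assoc)
      also have "y * r' * x ^ Suc l = 0"
        using kill[OF right_ideal_mult[OF I y(1)]] .
      finally have "k * x ^ l = - (c *s (y * x ^ l))"
        by (simp add: eq_neg_iff_add_eq_0 add.commute)
      then have "y * x ^ l = k * x ^ l * ((- inverse c) *s 1)"
        using \<open>c \<noteq> 0\<close> by (simp add: scale_mult_right)
      then have "y * x ^ l \<in> K"
        using right_ideal_mult[OF K(1) right_ideal_mult[OF K(1) k(1)]] by metis
      then show False
        using K(3) y(3) by auto
    qed
    define z1 where "z1 = z - y * r'"
    have "z1 \<notin> L"
    proof
      assume "z1 \<in> L"
      moreover have "y * r' \<in> L" using Y_L by auto
      ultimately have "z1 + y * r' \<in> L" by (rule right_ideal_add[OF L])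
      then show False using \<open>z \<notin> L\<close> by (simp add: z1_def)
    qed
    then obtain t where t: "z1 * e t \<notin> L"
      using homogeneous_component_outside[OF L] by blast
    \<comment> \<open>Restricting to one vertex makes the line spanned by \<open>w\<close> stable under the idempotents, so that
      \<open>K\<close> and \<open>w\<close> together span a right ideal.\<close>
    define w where "w = z1 * e t"
    have w: "w \<notin> L" using t by (simp add: w_def)
    have w_e: "w * e i = (if t mod int N = i mod int N then w else 0)" for i
      using e_cong[of t i] by (simp add: w_def mult.assoc e_mult_e)
    have "w * x = (z1 * x) * e (t + 1)"
      by (simp add: w_def mult.assoc e_x)
    also have "z1 * x = k"
      using zx \<open>c = 0\<close> by (simp add: z1_def left_diff_distrib)
    finally have w_x: "w * x \<in> K"
      using right_ideal_mult[OF K(1) k(1)] by simp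
    have "w \<in> I"
      unfolding w_def z1_def using I z y(1) by (intro right_ideal_mult right_ideal_diff) auto
    define X where "X = {b + d *s w | b d. b \<in> K}"
    have "right_ideal X"
    proof (rule right_idealI)
      show "0 \<in> X"
        unfolding X_def using right_ideal_zero[OF K(1)] by (auto intro!: exI[of _ 0])
    next
      fix a b
      assume "a \<in> X" "b \<in> X"
      then obtain a' d b' d' where *: "a' \<in> K" "b' \<in> K" "a = a' + d *s w" "b = b' + d' *s w"
        by (auto simp: X_def)
      then have "a + b = (a' + b') + (d + d') *s w"
        by (simp add: scale_left_distrib)
      then show "a + b \<in> X"
        using right_ideal_add[OF K(1) *(1,2)] unfolding X_def by blast
    next
      fix c a
      assume "a \<in> X"
      then obtain b d where *: "b \<in> K" "a = b + d *s w" by (auto simp: X_def)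
      then have "c *s a = c *s b + (c * d) *s w"
        by (simp add: scale_right_distrib)
      then show "c *s a \<in> X"
        using right_ideal_scale[OF K(1) *(1)] unfolding X_def by blast
    next
      fix a
      assume "a \<in> X"
      then obtain b d where *: "b \<in> K" "a = b + d *s w" by (auto simp: X_def)
      then have "a * x = (b * x + d *s (w * x)) + 0 *s w"
        by (simp add: distrib_right scale_mult_left)
      moreover have "b * x + d *s (w * x) \<in> K"
        using right_ideal_add[OF K(1) right_ideal_mult[OF K(1) *(1)]
            right_ideal_scale[OF K(1) w_x]] .
      ultimately show "a * x \<in> X" unfolding X_def by blast
    next
      fix a i
      assume "a \<in> X"
      then obtain b d where *: "b \<in> K" "a = b + d *s w" by (auto simp: X_def)
      then have "a * e i = b * e i + (if t mod int N = i mod int N then d else 0) *s w"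
        by (simp add: distrib_right scale_mult_left w_e)
      then show "a * e i \<in> X"
        using right_ideal_mult[OF K(1) *(1)] unfolding X_def by blast
    qed
    moreover have "X \<subseteq> I"
      using K(2) \<open>w \<in> I\<close> right_ideal_add[OF I] right_ideal_scale[OF I] by (auto simp: X_def)
    moreover have "?Y \<inter> X = {0}"
    proof -
      have "a = 0" if "a \<in> ?Y" "a \<in> X" for a
      proof -
        obtain b d where b: "b \<in> K" "a = b + d *s w"
          using \<open>a \<in> X\<close> by (auto simp: X_def)
        have "d = 0"
        proof (rule ccontr)
          assume "d \<noteq> 0"
          then have "w = inverse d *s (a - b)"
            using b by simp
          moreover have "a - b \<in> L"
            using right_ideal_diff[OF L] Y_L K_L that(1) b(1) by blast
          ultimately show False
            using w right_ideal_scale[OF L] by blast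
        qed
        then show ?thesis using b that(1) K(3) by auto
      qed
      then show ?thesis
        using right_ideal_zero[OF Y] right_ideal_zero[OF \<open>right_ideal X\<close>] by blast
    qed
    moreover have "K \<subseteq> X"
    proof
      fix b assume "b \<in> K"
      moreover have "b = b + 0 *s w" by simp
      ultimately show "b \<in> X" unfolding X_def by blast
    qed
    ultimately have "X = K" by (rule max)
    moreover have "w \<in> X"
    proof -
      have "w = 0 + 1 *s w" by simp
      then show ?thesis
        unfolding X_def using right_ideal_zero[OF K(1)] by blast
    qed
    ultimately show False
      using w K_L by blast
  qed
  then have "I = L" using L_I by blast
  then show ?thesis
    using that[of K] K by (simp add: L_def)
qed

text \<open>The generator is chosen to survive the highest power of \<open>x\<close> that does not kill \<open>I\<close>; such an
  element can be found at a single vertex because the idempotents sum to \<open>1\<close>.\<close>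

lemma indecomposable_homogeneous_principal:
  assumes "indecomposable_right_ideal I"
  obtains y j where "I = range ((*) y)" "y * e j = y" "y \<noteq> 0"
proof -
  have I: "right_ideal I" "I \<noteq> {0}"
    using assms by (auto simp: indecomposable_right_ideal_def)
  define n where "n = (LEAST n. \<forall>z\<in>I. z * x ^ n = 0)"
  have "\<forall>z\<in>I. z * x ^ N = 0"
    by (simp add: x_power_N)
  then have n: "\<forall>z\<in>I. z * x ^ n = 0"
    unfolding n_def by (rule LeastI)
  have "n \<noteq> 0"
    using n I right_ideal_zero[OF I(1)] by auto
  then obtain l where l: "n = Suc l" by (cases n) auto
  have "\<not> (\<forall>z\<in>I. z * x ^ l = 0)"
    using not_less_Least[of l "\<lambda>n. \<forall>z\<in>I. z * x ^ n = 0"] l unfolding n_def by simp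
  then obtain z where z: "z \<in> I" "z * x ^ l \<noteq> 0" by blast
  have "(\<Sum>s<N. z * e (int s) * x ^ l) = z * x ^ l"
    by (simp add: sum_distrib_right[symmetric] sum_distrib_left[symmetric] sum_e)
  then obtain s where s: "z * e (int s) * x ^ l \<noteq> 0"
    using z(2) by (metis (no_types, lifting) sum.neutral)
  define y where "y = z * e (int s)"
  have y: "y \<in> I" "y * e (int s) = y" "y * x ^ l \<noteq> 0"
    using s right_ideal_mult[OF I(1) z(1)] by (simp_all add: y_def mult.assoc e_idem)
  obtain K where K: "right_ideal K" "range ((*) y) \<inter> K = {0}"
    "I = {a + b | a b. a \<in> range ((*) y) \<and> b \<in> K}"
    by (rule longest_homogeneous_splits[OF I(1) _ y, of thesis]) (use n l in auto)
  have "y \<noteq> 0"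
    using y(3) by auto
  moreover have "y \<in> range ((*) y)" by (metis mult_1_right rangeI)
  ultimately have "range ((*) y) \<noteq> {0}" by auto
  moreover have "range ((*) y) = {0} \<or> K = {0}"
    using assms right_ideal_range[of y] K unfolding indecomposable_right_ideal_def by simp
  ultimately have "K = {0}" by simp
  then have "I = range ((*) y)"
    using K(3) by auto
  then show ?thesis
    using that y(2) \<open>y \<noteq> 0\<close> by blast
qed

lemma indecomposable_iff_unit_image:
  "indecomposable_right_ideal I \<longleftrightarrow>
    (\<exists>r s t. I = (*) (1 + r * x) ` taft_N scale N q g x s t \<and> r \<in> R \<and> s < N \<and> t < N)"
proof
  assume "indecomposable_right_ideal I"
  then obtain y j where y: "I = range ((*) y)" "y * e j = y" "y \<noteq> 0"
    by (rule indecomposable_homogeneous_principal)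
  obtain r s t where "r \<in> R" "s < N" "t < N"
    "range ((*) y) = (*) (1 + r * x) ` taft_N scale N q g x s t"
    using y(2,3) by (rule homogeneous_principal_eq_unit_image)
  then show "\<exists>r s t. I = (*) (1 + r * x) ` taft_N scale N q g x s t \<and> r \<in> R \<and> s < N \<and> t < N"
    unfolding y(1) by (intro exI conjI)
next
  assume "\<exists>r s t. I = (*) (1 + r * x) ` taft_N scale N q g x s t \<and> r \<in> R \<and> s < N \<and> t < N"
  then obtain r s t where "I = (*) (1 + r * x) ` taft_N scale N q g x s t" "r \<in> R" "t < N"
    by (elim exE conjE)
  then show "indecomposable_right_ideal I"
    by (simp only: indecomposable_unit_image)
qed

end

theorem theorem28:
  fixes scale :: "'k::field \<Rightarrow> 'a::ring_1 \<Rightarrow> 'a"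
    and N :: nat and q :: 'k and g x :: 'a
  assumes "N \<ge> 2"
    and "primitive_root_of_unity N q"
    and "taft_algebra scale N q g x"
  shows "(\<forall>s<N. \<forall>t<N. taft_N scale N q g x s t \<in> indecomposable_right_ideals) \<and>
    (\<forall>I \<in> indecomposable_right_ideals.
       \<exists>!(s, t). s < N \<and> t < N \<and> right_module_isomorphic I (taft_N scale N q g x s t)) \<and>
    (indecomposable_right_ideals :: 'a set set) =
      {(\<lambda>y. (1 + r * x) * y) ` taft_N scale N q g x s t | r s t.
         r \<in> taft_R scale x \<and> s < N \<and> t < N}"
proof -
  interpret associative_algebra scale
    using assms(3) unfolding taft_algebra_def presented_algebra_def by (elim conjE)
  interpret taft scale N q g x
    by unfold_locales (fact assms)+
  have unique: "\<exists>!(s, t). s < N \<and> t < N \<and>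
      right_module_isomorphic I (taft_N scale N q g x s t)"
    if indec: "indecomposable_right_ideal I" for I
  proof -
    have I: "right_ideal I"
      using indec by (simp add: indecomposable_right_ideal_def)
    obtain r s t where *: "r \<in> R" "s < N" "t < N"
      "I = (*) (1 + r * x) ` taft_N scale N q g x s t"
      using indec unfolding indecomposable_iff_unit_image by (elim exE conjE)
    obtain v where "v * (1 + r * x) = 1"
      using unit_one_plus[OF *(1)] by blast
    then have iso: "right_module_isomorphic I (taft_N scale N q g x s t)"
      unfolding *(4) by (rule right_module_isomorphic_image_unit)
    have eq: "s' = s \<and> t' = t"
      if "s' < N" "t' < N" "right_module_isomorphic I (taft_N scale N q g x s' t')" for s' t'
      using right_module_isomorphic_annihilator[OF that(3) I]
        right_module_isomorphic_annihilator[OF iso I]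
      by (intro taft_N_eq_if_annihilators_eq that(1,2) *(2,3)) simp
    show ?thesis
    proof (rule ex1I[of _ "(s, t)"])
      show "case (s, t) of (s, t) \<Rightarrow>
          s < N \<and> t < N \<and> right_module_isomorphic I (taft_N scale N q g x s t)"
        using *(2,3) iso by simp
    next
      fix p
      assume p: "case p of (s, t) \<Rightarrow>
          s < N \<and> t < N \<and> right_module_isomorphic I (taft_N scale N q g x s t)"
      obtain s' t' where p_eq: "p = (s', t')" by (cases p)
      show "p = (s, t)"
        using p eq[of s' t'] unfolding p_eq by simp
    qed
  qed
  have "(indecomposable_right_ideals :: 'a set set) =
      {(\<lambda>y. (1 + r * x) * y) ` taft_N scale N q g x s t | r s t.
         r \<in> taft_R scale x \<and> s < N \<and> t < N}"
    unfolding indecomposable_right_ideals_def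
    by (intro Collect_cong indecomposable_iff_unit_image)
  moreover have "\<forall>s<N. \<forall>t<N. taft_N scale N q g x s t \<in> indecomposable_right_ideals"
    unfolding indecomposable_right_ideals_def mem_Collect_eq
    by (intro allI impI indecomposable_taft_N)
  moreover have "\<forall>I \<in> indecomposable_right_ideals.
      \<exists>!(s, t). s < N \<and> t < N \<and> right_module_isomorphic I (taft_N scale N q g x s t)"
    unfolding indecomposable_right_ideals_def by (intro ballI unique) (simp only: mem_Collect_eq)
  ultimately show ?thesis
    by (intro conjI)
qed

end
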